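(* For every $k \ge 1$, the matrix $\mathbf{A}^{\mathrm{P}}_k$ generated by the structured BFGS-Plus recursion $$\mathbf{A}^{\mathrm{P}}_{i+1} = \mathbf{A}^{\mathrm{P}}_i - \frac{1}{\mathbf{s}_i^T\widehat{\mathbf{B}}^{\mathrm{P}}_i\mathbf{s}_i}\,\widehat{\mathbf{B}}^{\mathrm{P}}_i\mathbf{s}_i\mathbf{s}_i^T\widehat{\mathbf{B}}^{\mathrm{P}}_i + \frac{1}{\mathbf{s}_i^T\mathbf{u}_i}\,\mathbf{u}_i\mathbf{u}_i^T,\qquad \widehat{\mathbf{B}}^{\mathrm{P}}_i = \mathbf{A}^{\mathrm{P}}_i + \mathbf{K}_{i+1},\qquad i\ge 0,$$ has the compact representation $$\mathbf{A}^{\mathrm{P}}_k = \mathbf{A}^{\mathrm{P}}_0 - \begin{bmatrix}\mathbf{Q}_k & \mathbf{U}_k\end{bmatrix}\begin{bmatrix}\mathbf{D}^{\mathrm{V}}_k + \mathbf{L}^{\mathrm{V}}_k + (\mathbf{L}^{\mathrm{V}}_k)^T + \mathbf{S}_k^T\mathbf{A}^{\mathrm{P}}_0\mathbf{S}_k & \mathbf{L}^{\mathrm{U}}_k\\ (\mathbf{L}^{\mathrm{U}}_k)^T & -\mathbf{D}^{\mathrm{U}}_k\end{bmatrix}^{-1}\begin{bmatrix}\mathbf{Q}_k^T\\ \mathbf{U}_k^T\end{bmatrix},$$ where $\mathbf{Q}_k = \mathbf{V}_k + \mathbf{A}^{\mathrm{P}}_0\mathbf{S}_k$.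
   Context: Setting: $f = \widehat{k} + \widehat{u}$ with $\widehat{k},\widehat{u}:\mathbb{R}^n\to\mathbb{R}$ twice continuously differentiable; $\mathbf{x}_0,\mathbf{x}_1,\dots$ is a sequence of points in $\mathbb{R}^n$. For $i\ge 0$ put $\mathbf{s}_i = \mathbf{x}_{i+1}-\mathbf{x}_i$, $\mathbf{K}_i = \nabla^2\widehat{k}(\mathbf{x}_i)\in\mathbb{R}^{n\times n}$ (symmetric), $\mathbf{v}_i = \mathbf{K}_{i+1}\mathbf{s}_i$, and $$\mathbf{u}_i = \mathbf{K}_{i+1}\mathbf{s}_i + \left(\nabla\widehat{u}(\mathbf{x}_{i+1}) - \nabla\widehat{u}(\mathbf{x}_i)\right).$$ The initial matrix $\mathbf{A}^{\mathrm{P}}_0\in\mathbb{R}^{n\times n}$ is a given symmetric matrix. The recursion is assumed to be well defined, i.e. $\mathbf{s}_i^T\widehat{\mathbf{B}}^{\mathrm{P}}_i\mathbf{s}_i\neq0$ and $\mathbf{s}_i^T\mathbf{u}_i\ne0$ for all $i\ge0$. For $k\ge1$: $\mathbf{S}_k = [\mathbf{s}_0,\dots,\mathbf{s}_{k-1}]$, $\mathbf{U}_k = [\mathbf{u}_0,\dots,\mathbf{u}_{k-1}]$, $\mathbf{V}_k = [\mathbf{v}_0,\dots,\mathbf{v}_{k-1}]$, all in $\mathbb{R}^{n\times k}$. Write $\mathbf{S}_k^T\mathbf{U}_k = \mathbf{L}^{\mathrm{U}}_k + \mathbf{R}^{\mathrm{U}}_k$ and $\mathbf{S}_k^T\mathbf{V}_k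 = \mathbf{L}^{\mathrm{V}}_k + \mathbf{R}^{\mathrm{V}}_k$, where $\mathbf{L}^{\mathrm{U}}_k,\mathbf{L}^{\mathrm{V}}_k\in\mathbb{R}^{k\times k}$ are strictly lower triangular and $\mathbf{R}^{\mathrm{U}}_k,\mathbf{R}^{\mathrm{V}}_k\in\mathbb{R}^{k\times k}$ are upper triangular (including the diagonal); $\mathbf{D}^{\mathrm{U}}_k$ and $\mathbf{D}^{\mathrm{V}}_k$ are the $k\times k$ diagonal matrices formed from the diagonals of $\mathbf{S}_k^T\mathbf{U}_k$ and $\mathbf{S}_k^T\mathbf{V}_k$, respectively. *)

theory Defs
  imports "HOL-Analysis.Analysis" "Jordan_Normal_Form.Gauss_Jordan_Elimination"
begin

text \<open>
  Gradients and Hessians live on \<open>real^'n\<close>, where differentiation is available; all matrix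
  algebra is done with the dimension-polymorphic matrices of \<open>Jordan_Normal_Form\<close>, so that the
  number of columns \<open>k\<close> can be an ordinary natural number.
\<close>

no_notation Finite_Cartesian_Product.vec_nth (infixl \<open>$\<close> 90)
no_notation Inner_Product.real_inner_class.inner (infix \<open>\<bullet>\<close> 70)

definition gradient :: "(real^'n \<Rightarrow> real) \<Rightarrow> real^'n \<Rightarrow> real^'n" where
  "gradient f x = (\<chi> i. frechet_derivative f (at x) (axis i 1))"

definition hessian :: "(real^'n \<Rightarrow> real) \<Rightarrow> real^'n \<Rightarrow> real^'n^'n" where
  "hessian f x = jacobian (gradient f) (at x)"

definition twice_continuously_differentiable :: "(real^'n \<Rightarrow> real) \<Rightarrow> bool" where
  "twice_continuously_differentiable f \<longleftrightarrow>
     (\<forall>x. f differentiable (at x)) \<and> (\<forall>x. gradient f differentiable (at x)) \<and>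
     continuous_on UNIV (hessian f)"

lemma GDERIV_gradient:
  fixes f :: "real^'n \<Rightarrow> real"
  assumes "f differentiable (at x)"
  shows "GDERIV f x :> gradient f x"
proof -
  have d: "(f has_derivative frechet_derivative f (at x)) (at x)"
    using assms frechet_derivative_works by blast
  then have lin: "linear (frechet_derivative f (at x))"
    by (rule has_derivative_linear)
  have "frechet_derivative f (at x) h = inner h (gradient f x)" for h
  proof -
    have "frechet_derivative f (at x) h =
        frechet_derivative f (at x) (\<Sum>i\<in>UNIV. vec_nth h i *\<^sub>R axis i 1)"
      using basis_expansion[of h] by (simp add: scalar_mult_eq_scaleR)
    also have "\<dots> = inner h (gradient f x)"
      by (simp add: linear_sum[OF lin] linear_cmul[OF lin] inner_vec_def gradient_def)
    finally show ?thesis .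
  qed
  then have "frechet_derivative f (at x) = (\<lambda>h. inner h (gradient f x))"
    by (rule ext)
  with d show ?thesis
    by (simp add: gderiv_def)
qed

text \<open>
  The index type \<open>'n\<close> carries no order; \<open>from_nat_into UNIV\<close> restricted to \<open>{..<CARD('n)}\<close> is one
  fixed bijection onto \<open>'n\<close>, used for all vectors and for rows and columns of all matrices.
\<close>

definition to_vec :: "real^'n \<Rightarrow> real vec" where
  "to_vec v = Matrix.vec CARD('n) (\<lambda>i. vec_nth v (from_nat_into UNIV i))"

definition to_mat :: "real^'n^'n \<Rightarrow> real mat" where
  "to_mat M = Matrix.mat CARD('n) CARD('n)
     (\<lambda>(i, j). vec_nth (vec_nth M (from_nat_into UNIV i)) (from_nat_into UNIV j))"

definition outer_prod :: "'a::times vec \<Rightarrow> 'a vec \<Rightarrow> 'a mat" where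
  "outer_prod v w = Matrix.mat (dim_vec v) (dim_vec w) (\<lambda>(i, j). v $ i * w $ j)"

definition append_cols :: "'a::zero mat \<Rightarrow> 'a mat \<Rightarrow> 'a mat" (infixr \<open>@\<^sub>c\<close> 65) where
  "A @\<^sub>c B = four_block_mat A B (0\<^sub>m 0 (dim_col A)) (0\<^sub>m 0 (dim_col B))"

definition strict_lower :: "'a::zero mat \<Rightarrow> 'a mat" where
  "strict_lower M =
     Matrix.mat (dim_row M) (dim_col M) (\<lambda>(i, j). if j < i then M $$ (i, j) else 0)"

definition diag_part :: "'a::zero mat \<Rightarrow> 'a mat" where
  "diag_part M = mat_diag (dim_row M) (\<lambda>i. M $$ (i, i))"

lemma strict_lower_unique:
  fixes M :: "'a::comm_monoid_add mat"
  assumes "L \<in> carrier_mat k k" "R \<in> carrier_mat k k" "M = L + R"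
    and "\<And>i j. i \<le> j \<Longrightarrow> j < k \<Longrightarrow> L $$ (i, j) = 0" and "upper_triangular R"
  shows "L = strict_lower M"
proof (rule eq_matI)
  fix i j
  assume "i < dim_row (strict_lower M)" "j < dim_col (strict_lower M)"
  then show "L $$ (i, j) = strict_lower M $$ (i, j)"
    using assms by (auto simp: strict_lower_def upper_triangular_def)
qed (use assms in \<open>auto simp: strict_lower_def\<close>)

end

theory Submission
  imports Defs "Jordan_Normal_Form.Determinant"
begin

text \<open>
  The idea is to change the basis from the columns of \<open>[Q U]\<close>, which involve only the
  initial matrix \<open>A\<^sub>0\<close>, to the vectors that the recursion actually subtracts and adds. Put
  \<open>w\<^sub>i = B\<^sub>i s\<^sub>i\<close>, \<open>\<sigma>\<^sub>i = s\<^sub>i\<^sup>T w\<^sub>i\<close> and \<open>\<tau>\<^sub>i = s\<^sub>i\<^sup>T u\<^sub>i\<close>. Since \<open>B\<^sub>i\<close> is symmetric, unrolling the recursion gives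
  \<open>A\<^sub>k = A\<^sub>0 - [W U] diag(\<sigma>, -\<tau>)\<^sup>-\<^sup>1 [W U]\<^sup>T\<close>, a compact representation with a diagonal middle matrix
  (\<open>bilinear_A\<close>).

  Applying the unrolled formula for \<open>A\<^sub>i\<close> to \<open>s\<^sub>i\<close> expresses the column \<open>q\<^sub>i = v\<^sub>i + A\<^sub>0 s\<^sub>i\<close> of \<open>Q\<close> as
  \<open>w\<^sub>i\<close> plus a combination of \<open>w\<^sub>l\<close> and \<open>u\<^sub>l\<close> with \<open>l < i\<close>. Hence \<open>[Q U] = [W U] T\<close>, where
  \<open>T = [X 0; Y 1]\<close> with \<open>X\<close> unit upper triangular (\<open>QU_eq\<close>); in particular \<open>det T = 1\<close>. The
  same formula, tested between \<open>s\<^sub>j\<close> and \<open>s\<^sub>i\<close>, shows that the middle matrix of the theorem is the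
  congruent matrix \<open>M = T\<^sup>T diag(\<sigma>, -\<tau>) T\<close> (\<open>M_eq\<close>). So \<open>M\<close> is invertible, and \<open>T\<close> cancels:
  \<open>[Q U] M\<^sup>-\<^sup>1 [Q U]\<^sup>T = [W U] diag(\<sigma>, -\<tau>)\<^sup>-\<^sup>1 [W U]\<^sup>T\<close> (\<open>congruence_inverse\<close>), which is \<open>A\<^sub>0 - A\<^sub>k\<close>.

  Analysis enters at a single point. The symmetry of \<open>B\<^sub>i\<close> rests on the symmetry of the
  Hessians of \<open>khat\<close>, which is Schwarz's theorem on mixed second derivatives
  (\<open>hessian_symmetric\<close>).
\<close>

section \<open>Symmetry of the Hessian\<close>

text \<open>
  Two applications of the mean value theorem: once along \<open>d\<close> to the difference of the values
  of \<open>f\<close> on two parallel segments, once along \<open>e\<close> to the resulting directional derivative.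
  The left-hand side is symmetric in \<open>d\<close> and \<open>e\<close>, the right-hand side a priori is not.
\<close>

lemma second_difference_eq_hessian:
  fixes f :: "real^'n \<Rightarrow> real"
  assumes f: "\<And>z. f differentiable (at z)" and g: "\<And>z. gradient f differentiable (at z)"
    and h: "0 < h"
  shows "\<exists>p q. 0 < p \<and> p < h \<and> 0 < q \<and> q < h \<and>
    f (z + h *\<^sub>R d + h *\<^sub>R e) - f (z + h *\<^sub>R d) - f (z + h *\<^sub>R e) + f z
      = h\<^sup>2 * inner d (hessian f (z + p *\<^sub>R d + q *\<^sub>R e) *v e)"
proof -
  have f': "(f has_derivative (\<lambda>y. inner y (gradient f w))) (at w)" for w
    using GDERIV_gradient[OF f[of w]] by (simp add: gderiv_def)
  have line: "((\<lambda>t. f (w + t *\<^sub>R d)) has_real_derivative inner d (gradient f (w + t *\<^sub>R d))) (at t)"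
    for w t
  proof -
    have "((\<lambda>t. w + t *\<^sub>R d) has_derivative (\<lambda>h. h *\<^sub>R d)) (at t)"
      by (auto intro!: derivative_eq_intros)
    from has_derivative_compose[OF this f'] show ?thesis
      unfolding has_field_derivative_def
      by (rule has_derivative_eq_rhs) (simp add: fun_eq_iff)
  qed
  have "((\<lambda>t. f (z + h *\<^sub>R e + t *\<^sub>R d) - f (z + t *\<^sub>R d)) has_real_derivative
      inner d (gradient f (z + h *\<^sub>R e + t *\<^sub>R d)) - inner d (gradient f (z + t *\<^sub>R d))) (at t)" for t
    by (intro DERIV_diff line)
  from MVT2[OF h this] obtain p where p: "0 < p" "p < h" and
    1: "f (z + h *\<^sub>R e + h *\<^sub>R d) - f (z + h *\<^sub>R d) - (f (z + h *\<^sub>R e) - f z) =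
      h * (inner d (gradient f (z + h *\<^sub>R e + p *\<^sub>R d)) - inner d (gradient f (z + p *\<^sub>R d)))"
    by auto
  have g': "(gradient f has_derivative (\<lambda>h. hessian f w *v h)) (at w)" for w
    using g[of w] unfolding hessian_def by (simp add: jacobian_works)
  have "((\<lambda>t. inner d (gradient f (z + p *\<^sub>R d + t *\<^sub>R e))) has_real_derivative
      inner d (hessian f (z + p *\<^sub>R d + t *\<^sub>R e) *v e)) (at t)" for t
    unfolding has_field_derivative_def
    by (rule derivative_eq_intros has_derivative_compose[OF _ g'] refl | simp add: fun_eq_iff matrix_vector_mult_scaleR)+
  from MVT2[OF h this] obtain q where q: "0 < q" "q < h" and
    2: "inner d (gradient f (z + p *\<^sub>R d + h *\<^sub>R e)) - inner d (gradient f (z + p *\<^sub>R d)) =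
      h * inner d (hessian f (z + p *\<^sub>R d + q *\<^sub>R e) *v e)"
    by auto
  show ?thesis
    using p q 1 2 by (intro exI[of _ p] exI[of _ q]) (simp add: power2_eq_square add.assoc add.commute[of "_ *\<^sub>R e"])
qed

text \<open>
  Schwarz's theorem: exchanging the two directions in \<open>second_difference_eq_hessian\<close> shows
  that the two mixed derivatives agree at points arbitrarily close to \<open>z\<close>, and by continuity
  they agree at \<open>z\<close>.
\<close>

lemma hessian_symmetric:
  fixes f :: "real^'n \<Rightarrow> real"
  assumes "twice_continuously_differentiable f"
  shows "Finite_Cartesian_Product.transpose (hessian f z) = hessian f z"
proof -
  have f: "f differentiable (at w)" and g: "gradient f differentiable (at w)" for w
    using assms by (auto simp: twice_continuously_differentiable_def)
  have cont: "isCont (hessian f) z"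
    using assms by (auto simp: twice_continuously_differentiable_def continuous_on_eq_continuous_at)
  have bil: "inner d (hessian f z *v e) = inner e (hessian f z *v d)" for d e
  proof -
    define r where "r m = inverse (real (Suc m))" for m
    have r: "0 < r m" for m by (simp add: r_def)
    have r0: "r \<longlonglongrightarrow> 0"
      unfolding r_def by (rule LIMSEQ_inverse_real_of_nat)
    have "\<exists>p q p' q'. 0 < p \<and> p < r m \<and> 0 < q \<and> q < r m \<and> 0 < p' \<and> p' < r m \<and> 0 < q' \<and> q' < r m
      \<and> inner d (hessian f (z + p *\<^sub>R d + q *\<^sub>R e) *v e) = inner e (hessian f (z + p' *\<^sub>R e + q' *\<^sub>R d) *v d)" for m
    proof -
      obtain p q where 1: "0 < p" "p < r m" "0 < q" "q < r m"
        "f (z + r m *\<^sub>R d + r m *\<^sub>R e) - f (z + r m *\<^sub>R d) - f (z + r m *\<^sub>R e) + f z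
      = (r m)\<^sup>2 * inner d (hessian f (z + p *\<^sub>R d + q *\<^sub>R e) *v e)"
        using second_difference_eq_hessian[OF f g r] by blast
      obtain p' q' where 2: "0 < p'" "p' < r m" "0 < q'" "q' < r m"
        "f (z + r m *\<^sub>R e + r m *\<^sub>R d) - f (z + r m *\<^sub>R e) - f (z + r m *\<^sub>R d) + f z
      = (r m)\<^sup>2 * inner e (hessian f (z + p' *\<^sub>R e + q' *\<^sub>R d) *v d)"
        using second_difference_eq_hessian[OF f g r] by blast
      have "z + r m *\<^sub>R e + r m *\<^sub>R d = z + r m *\<^sub>R d + r m *\<^sub>R e" by simp
      then have "inner d (hessian f (z + p *\<^sub>R d + q *\<^sub>R e) *v e) = inner e (hessian f (z + p' *\<^sub>R e + q' *\<^sub>R d) *v d)"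
        using 1(5) 2(5) r[of m] by (simp add: algebra_simps)
      with 1 2 show ?thesis by blast
    qed
    then obtain p q p' q' where b: "\<And>m. 0 < p m \<and> p m < r m \<and> 0 < q m \<and> q m < r m \<and> 0 < p' m \<and> p' m < r m \<and> 0 < q' m \<and> q' m < r m"
      and eq: "\<And>m. inner d (hessian f (z + p m *\<^sub>R d + q m *\<^sub>R e) *v e) = inner e (hessian f (z + p' m *\<^sub>R e + q' m *\<^sub>R d) *v d)"
      by metis
    have squeeze: "a \<longlonglongrightarrow> 0" if "\<And>m. 0 < a m \<and> a m < r m" for a :: "nat \<Rightarrow> real"
      by (rule tendsto_sandwich[OF _ _ tendsto_const r0]) (use that in \<open>auto intro!: always_eventually less_imp_le\<close>)
    have lim: "(\<lambda>m. inner v (hessian f (z + a m *\<^sub>R v + c m *\<^sub>R w) *v w)) \<longlonglongrightarrow> inner v (hessian f z *v w)"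
      if "\<And>m. 0 < a m \<and> a m < r m" "\<And>m. 0 < c m \<and> c m < r m" for a c v w
    proof -
      have "(\<lambda>m. z + a m *\<^sub>R v + c m *\<^sub>R w) \<longlonglongrightarrow> z + 0 *\<^sub>R v + 0 *\<^sub>R w"
        by (intro tendsto_intros squeeze that)
      then have "(\<lambda>m. hessian f (z + a m *\<^sub>R v + c m *\<^sub>R w)) \<longlonglongrightarrow> hessian f z"
        by (intro isCont_tendsto_compose[OF cont]) simp
      then show ?thesis
        unfolding matrix_vector_mult_def inner_vec_def
        by (simp, intro tendsto_intros) 
    qed
    show ?thesis
      by (rule LIMSEQ_unique[OF lim[of p q d e]]) (use b lim[of p' q' e d] in \<open>simp_all add: eq\<close>)
  qed
  show ?thesis
    using bil[of "axis _ 1" "axis _ 1"]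
    by (simp add: Finite_Cartesian_Product.transpose_def vec_eq_iff inner_axis' matrix_vector_mult_basis column_def)
qed

lemma transpose_to_mat: "(to_mat H)\<^sup>T = to_mat (Finite_Cartesian_Product.transpose H)"
  by (rule eq_matI) (auto simp: to_mat_def Finite_Cartesian_Product.transpose_def)

section \<open>Block, inverse and rank-one matrices\<close>

lemma append_cols_carrier:
  assumes "A \<in> carrier_mat n k" "B \<in> carrier_mat n l"
  shows "A @\<^sub>c B \<in> carrier_mat n (k + l)"
  using assms four_block_carrier_mat[of A n k "0\<^sub>m 0 l" 0 l B "0\<^sub>m 0 k"] by (simp add: append_cols_def)

lemma append_cols_mult_four_block_mat:
  assumes "A \<in> carrier_mat n k" "B \<in> carrier_mat n l"
    and "X \<in> carrier_mat k p" "Y \<in> carrier_mat k q" "Z \<in> carrier_mat l p" "W \<in> carrier_mat l q"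
  shows "(A @\<^sub>c B) * four_block_mat X Y Z W = (A * X + B * Z) @\<^sub>c (A * Y + B * W)"
  using assms unfolding append_cols_def
  by (subst mult_four_block_mat[of _ n k _ l _ 0 _ _ p _ q]) auto

lemma transpose_append_cols:
  assumes "A \<in> carrier_mat n k" "B \<in> carrier_mat n l"
  shows "(A @\<^sub>c B)\<^sup>T = A\<^sup>T @\<^sub>r B\<^sup>T"
  using assms unfolding append_cols_def append_rows_def
  by (subst transpose_four_block_mat[of _ n k _ l _ 0]) auto

lemma append_cols_mult_append_rows:
  assumes "A \<in> carrier_mat n k" "B \<in> carrier_mat n l" "C \<in> carrier_mat k m" "D \<in> carrier_mat l m"
  shows "(A @\<^sub>c B) * (C @\<^sub>r D) = A * C + B * D"
proof -
  have "(A @\<^sub>c B) * (C @\<^sub>r D) = four_block_mat (A * C + B * D) (0\<^sub>m n 0) (0\<^sub>m 0 m) (0\<^sub>m 0 0)"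
    using assms unfolding append_cols_def append_rows_def
    by (subst mult_four_block_mat[of _ n k _ l _ 0 _ _ m _ 0]) auto
  also have "\<dots> = A * C + B * D"
    using assms by (intro eq_matI) auto
  finally show ?thesis .
qed

lemma mat_inverse_eq:
  fixes M :: "'a::field mat"
  assumes M: "M \<in> carrier_mat m m" and N: "N \<in> carrier_mat m m" and MN: "M * N = 1\<^sub>m m"
  shows "invertible_mat M" and "mat_inverse M = Some N"
proof -
  have NM: "N * M = 1\<^sub>m m"
    using mat_mult_left_right_inverse[OF M N MN] .
  then show "invertible_mat M"
    using M N MN by (auto simp: invertible_mat_def inverts_mat_def square_mat.simps)
  have "M \<in> Units (ring_mat TYPE('a) m ())"
    using M N MN NM by (auto simp: Units_def ring_mat_def)
  then obtain N' where N': "mat_inverse M = Some N'"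
    using mat_inverse(1)[OF M, where b = "()"] by blast
  from mat_inverse(2)[OF M N'] have "M * N' = 1\<^sub>m m" and N'c: "N' \<in> carrier_mat m m"
    by auto
  then have "N = N * (M * N')" using N by simp
  also have "\<dots> = N'" using M N N'c NM by (simp add: assoc_mult_mat[symmetric, of _ m m _ m _ m])
  finally show "mat_inverse M = Some N" using N' by simp
qed

text \<open>
  The inverse of \<open>T\<^sup>T D T\<close> is \<open>T\<^sup>-\<^sup>1 E T\<^sup>-\<^sup>T\<close>, so \<open>T\<close> drops out when it is sandwiched
  between \<open>Z T\<close> and its transpose.
\<close>

lemma congruence_inverse:
  fixes T :: "'a::field mat"
  assumes T: "T \<in> carrier_mat m m" and D: "D \<in> carrier_mat m m" and E: "E \<in> carrier_mat m m"
    and Z: "Z \<in> carrier_mat n m"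
    and det: "det T \<noteq> 0" and DE: "D * E = 1\<^sub>m m"
  defines "M \<equiv> T\<^sup>T * D * T"
  shows "invertible_mat M" and "Z * T * the (mat_inverse M) * (Z * T)\<^sup>T = Z * E * Z\<^sup>T"
proof -
  from det_non_zero_imp_unit[OF T det, of "()"]
  obtain T' where T': "T' \<in> carrier_mat m m" and TT': "T * T' = 1\<^sub>m m" and T'T: "T' * T = 1\<^sub>m m"
    by (auto simp: Units_def ring_mat_def)
  have tr: "T\<^sup>T * T'\<^sup>T = 1\<^sub>m m" "T'\<^sup>T * T\<^sup>T = 1\<^sub>m m"
    using T T' TT' T'T by (simp_all flip: transpose_mult)
  define N where "N = T' * E * T'\<^sup>T"
  have N: "N \<in> carrier_mat m m" and M: "M \<in> carrier_mat m m"
    using T T' D E by (auto simp: N_def M_def)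
  have "M * N = T\<^sup>T * (D * ((T * T') * E)) * T'\<^sup>T"
    using T T' D E by (simp add: M_def N_def assoc_mult_mat[of _ m m _ m _ m])
  also have "\<dots> = 1\<^sub>m m"
    using T T' E by (simp add: TT' DE tr)
  finally have MN: "M * N = 1\<^sub>m m" .
  note inv = mat_inverse_eq[OF M N MN]
  show "invertible_mat M" by (rule inv)
  have "Z * T * N * (Z * T)\<^sup>T = Z * ((T * T') * E * (T'\<^sup>T * T\<^sup>T)) * Z\<^sup>T"
    using T T' E Z
    by (simp add: N_def transpose_mult[OF Z T] assoc_mult_mat[of _ n m _ m _ m] assoc_mult_mat[of _ n m _ m _ n]
       assoc_mult_mat[of _ m m _ m _ m] assoc_mult_mat[of _ m m _ m _ n])
  also have "\<dots> = Z * E * Z\<^sup>T"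
    using E by (simp add: TT' tr)
  finally show "Z * T * the (mat_inverse M) * (Z * T)\<^sup>T = Z * E * Z\<^sup>T"
    by (simp add: inv)
qed

lemma mult_outer_prod:
  fixes B :: "'a::comm_semiring_0 mat"
  assumes "B \<in> carrier_mat m n" "z \<in> carrier_vec n"
  shows "B * outer_prod z y = outer_prod (B *\<^sub>v z) y"
  using assms
  by (intro eq_matI) (auto simp: outer_prod_def scalar_prod_def sum_distrib_left sum_distrib_right ac_simps intro!: sum.cong)

lemma outer_prod_mult:
  fixes B :: "'a::comm_semiring_0 mat"
  assumes "B \<in> carrier_mat n m" "z \<in> carrier_vec n"
  shows "outer_prod y z * B = outer_prod y (B\<^sup>T *\<^sub>v z)"
  using assms
  by (intro eq_matI) (auto simp: outer_prod_def scalar_prod_def sum_distrib_left ac_simps intro!: sum.cong)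

text \<open>
  A product entry as a sum over the matrix entries leaves the scalar products inside these
  entries folded, unlike the definition of the scalar product itself.
\<close>

lemma index_mult_mat_sum:
  assumes "B \<in> carrier_mat n k" "C \<in> carrier_mat k m" "i < n" "j < m"
  shows "(B * C) $$ (i, j) = (\<Sum>l = 0..<k. B $$ (i, l) * C $$ (l, j))"
  using assms by (auto simp: scalar_prod_def)

lemma sum_if_less:
  fixes g :: "nat \<Rightarrow> 'a::comm_monoid_add"
  assumes "i \<le> k"
  shows "(\<Sum>l = 0..<k. if l < i then g l else 0) = (\<Sum>l<i. g l)"
proof -
  have "{l \<in> {0..<k}. l < i} = {..<i}" using assms by auto
  then show ?thesis by (simp flip: sum.inter_filter)
qed


section \<open>Compact representation of two-term symmetric updates\<close>

text \<open>
  The algebraic content of the recursion over an arbitrary field. Of the structured matrices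
  only the vectors \<open>v\<^sub>i\<close> remain: they account for the difference between \<open>w\<^sub>i = B\<^sub>i s\<^sub>i\<close> and
  \<open>A\<^sub>i s\<^sub>i\<close>.
\<close>

locale symmetric_two_term_update =
  fixes n :: nat and A0 :: "'a::field mat" and s u v w :: "nat \<Rightarrow> 'a vec" and A :: "nat \<Rightarrow> 'a mat"
  assumes s_carrier [simp]: "s i \<in> carrier_vec n"
    and u_carrier [simp]: "u i \<in> carrier_vec n"
    and v_carrier [simp]: "v i \<in> carrier_vec n"
    and A0_carrier [simp]: "A0 \<in> carrier_mat n n"
    and A0_sym: "A0\<^sup>T = A0"
    and A_carrier [simp]: "A i \<in> carrier_mat n n"
    and w_eq: "w i = A i *\<^sub>v s i + v i"
    and A_0: "A 0 = A0"
    and A_Suc: "A (Suc i) = A i - (1 / (s i \<bullet> w i)) \<cdot>\<^sub>m outer_prod (w i) (w i)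
                                + (1 / (s i \<bullet> u i)) \<cdot>\<^sub>m outer_prod (u i) (u i)"
    and sw: "s i \<bullet> w i \<noteq> 0"
    and su: "s i \<bullet> u i \<noteq> 0"
begin

lemma A_dims [simp]: "dim_row A0 = n" "dim_col A0 = n" "dim_row (A i) = n" "dim_col (A i) = n"
  using A0_carrier A_carrier[of i] by (auto simp only: carrier_matD)

lemma w_carrier [simp]: "w i \<in> carrier_vec n"
  unfolding w_eq by (intro add_carrier_vec mult_mat_vec_carrier[of _ n n]) auto

lemma dims [simp]: "dim_vec (s i) = n" "dim_vec (u i) = n" "dim_vec (v i) = n" "dim_vec (w i) = n"
  using s_carrier[of i] u_carrier[of i] v_carrier[of i] w_carrier[of i] by (auto simp only: carrier_vecD)

lemma dot_A0_commute:
  assumes "y \<in> carrier_vec n" "z \<in> carrier_vec n"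
  shows "z \<bullet> (A0 *\<^sub>v y) = y \<bullet> (A0 *\<^sub>v z)"
  using transpose_vec_mult_scalar[OF A0_carrier assms] A0_sym assms
    comm_scalar_prod[OF mult_mat_vec_carrier[OF A0_carrier assms(2)] assms(1)]
  by simp

text \<open>
  The unrolled recursion, as a bilinear form. It is used three times: with unit vectors it
  gives the entries of \<open>A\<^sub>k\<close>, with a unit vector and \<open>s\<^sub>i\<close> the columns of \<open>Q\<close>, and with \<open>s\<^sub>i\<close> and
  \<open>s\<^sub>j\<close> the upper left block of the middle matrix.
\<close>

lemma bilinear_A:
  assumes y: "y \<in> carrier_vec n" and z: "z \<in> carrier_vec n"
  shows "z \<bullet> (A i *\<^sub>v y) = z \<bullet> (A0 *\<^sub>v y)
           - (\<Sum>l<i. (w l \<bullet> z) * (w l \<bullet> y) / (s l \<bullet> w l))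
           + (\<Sum>l<i. (u l \<bullet> z) * (u l \<bullet> y) / (s l \<bullet> u l))"
proof (induction i)
  case 0
  then show ?case by (simp add: A_0)
next
  case (Suc i)
  have smult: "(c \<cdot>\<^sub>m outer_prod r r) *\<^sub>v y = (c * (r \<bullet> y)) \<cdot>\<^sub>v r" if "r \<in> carrier_vec n" for c r
    using that y
    by (intro eq_vecI) (auto simp: outer_prod_def scalar_prod_def sum_distrib_left ac_simps intro!: sum.cong)
  have outer: "c \<cdot>\<^sub>m outer_prod r r \<in> carrier_mat n n" if "r \<in> carrier_vec n" for c and r :: "'a vec"
    using that by (auto simp: outer_prod_def)
  have "A (Suc i) *\<^sub>v y = A i *\<^sub>v y - ((1 / (s i \<bullet> w i)) * (w i \<bullet> y)) \<cdot>\<^sub>v w i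
      + ((1 / (s i \<bullet> u i)) * (u i \<bullet> y)) \<cdot>\<^sub>v u i"
    unfolding A_Suc using y
    by (simp only: add_mult_distrib_mat_vec[of _ n n] minus_mult_distrib_mat_vec[of _ n n]
        smult outer minus_carrier_mat A_carrier w_carrier u_carrier)
  moreover have "A i *\<^sub>v y \<in> carrier_vec n"
    using y by (intro mult_mat_vec_carrier[of _ n n]) auto
  ultimately have "z \<bullet> (A (Suc i) *\<^sub>v y) = z \<bullet> (A i *\<^sub>v y)
      - (1 / (s i \<bullet> w i)) * (w i \<bullet> y) * (z \<bullet> w i) + (1 / (s i \<bullet> u i)) * (u i \<bullet> y) * (z \<bullet> u i)"
    using z by (simp add: scalar_prod_add_distrib[of _ n] scalar_prod_minus_distrib[of _ n])
  moreover have "z \<bullet> w i = w i \<bullet> z" "z \<bullet> u i = u i \<bullet> z"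
    using z by (simp_all add: comm_scalar_prod[of _ n])
  ultimately show ?case
    by (simp add: Suc.IH algebra_simps)
qed

context
  fixes k :: nat
begin

definition "S = mat_of_cols n (map s [0..<k])"
definition "U = mat_of_cols n (map u [0..<k])"
definition "V = mat_of_cols n (map v [0..<k])"
definition "W = mat_of_cols n (map w [0..<k])"
definition "Q = V + A0 * S"
definition "L\<^sub>U = strict_lower (S\<^sup>T * U)"
definition "L\<^sub>V = strict_lower (S\<^sup>T * V)"
definition "D\<^sub>U = diag_part (S\<^sup>T * U)"
definition "D\<^sub>V = diag_part (S\<^sup>T * V)"
definition "M = four_block_mat (D\<^sub>V + L\<^sub>V + L\<^sub>V\<^sup>T + S\<^sup>T * A0 * S) L\<^sub>U (L\<^sub>U\<^sup>T) (- D\<^sub>U)"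
text \<open>
  \<open>X\<close> and \<open>Y\<close> are the coefficients of the columns of \<open>Q\<close> with respect to those of \<open>W\<close> and \<open>U\<close>.
  The entry of \<open>X\<close> at \<open>(i, i)\<close> is \<open>(w\<^sub>i \<bullet> s\<^sub>i) / (s\<^sub>i \<bullet> w\<^sub>i) = 1\<close>, so one formula covers the
  diagonal and the part above it.
\<close>

definition "X = Matrix.mat k k (\<lambda>(l, i). if l < Suc i then (w l \<bullet> s i) / (s l \<bullet> w l) else 0)"
definition "Y = Matrix.mat k k (\<lambda>(l, i). if l < i then - (u l \<bullet> s i) / (s l \<bullet> u l) else 0)"
definition "T = four_block_mat X (0\<^sub>m k k) Y (1\<^sub>m k)"

lemma carriers [simp]:
  shows S_carrier: "S \<in> carrier_mat n k" and U_carrier: "U \<in> carrier_mat n k"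
    and V_carrier: "V \<in> carrier_mat n k" and W_carrier: "W \<in> carrier_mat n k"
    and Q_carrier: "Q \<in> carrier_mat n k"
    and X_carrier: "X \<in> carrier_mat k k" and Y_carrier: "Y \<in> carrier_mat k k"
    and T_carrier: "T \<in> carrier_mat (k + k) (k + k)"
    and L\<^sub>U_carrier: "L\<^sub>U \<in> carrier_mat k k" and L\<^sub>V_carrier: "L\<^sub>V \<in> carrier_mat k k"
    and D\<^sub>U_carrier: "D\<^sub>U \<in> carrier_mat k k" and D\<^sub>V_carrier: "D\<^sub>V \<in> carrier_mat k k"
  by (auto intro!: carrier_matI simp: S_def U_def V_def W_def Q_def X_def Y_def T_def L\<^sub>U_def L\<^sub>V_def D\<^sub>U_def D\<^sub>V_def
      strict_lower_def diag_part_def mat_diag_def)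

lemma carrier_dims [simp]:
  "dim_row S = n" "dim_col S = k" "dim_row U = n" "dim_col U = k"
  "dim_row V = n" "dim_col V = k" "dim_row W = n" "dim_col W = k"
  by (simp_all add: S_def U_def V_def W_def)

lemma cols [simp]:
  assumes "i < k"
  shows "col S i = s i" "col U i = u i" "col V i = v i" "col W i = w i"
  using assms by (simp_all add: S_def U_def V_def W_def)

lemma index_cols [simp]:
  assumes "i < k" "a < n"
  shows "S $$ (a, i) = s i $ a" "U $$ (a, i) = u i $ a" "V $$ (a, i) = v i $ a" "W $$ (a, i) = w i $ a"
  using assms by (simp_all add: S_def U_def V_def W_def mat_of_cols_index)

text \<open>The triangular factor has determinant \<open>1\<close> because \<open>X\<close> has unit diagonal.\<close>

lemma det_T: "det T \<noteq> 0"
proof -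
  have "upper_triangular X"
    by (auto simp: X_def)
  then have "det X = prod_list (diag_mat X)"
    by (rule det_upper_triangular) (rule X_carrier)
  also have "diag_mat X = map (\<lambda>i. 1) [0..<k]"
    using sw by (auto simp: diag_mat_def X_def comm_scalar_prod[of "w _" n "s _"])
  also have "prod_list \<dots> = (1 :: 'a)"
    by (simp add: map_replicate_const)
  finally show ?thesis
    by (simp add: T_def det_four_block_mat_upper_right_zero[of _ k _ k])
qed

text \<open>
  Solving \<open>w\<^sub>i = A\<^sub>i s\<^sub>i + v\<^sub>i\<close> for \<open>v\<^sub>i\<close> gives \<open>q\<^sub>i = w\<^sub>i + (A\<^sub>0 - A\<^sub>i) s\<^sub>i\<close>, and the unrolled recursion
  writes the last term through the earlier \<open>w\<^sub>l\<close> and \<open>u\<^sub>l\<close>.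
\<close>

lemma Q_eq: "Q = W * X + U * Y"
proof (rule eq_matI)
  fix a i assume "a < dim_row (W * X + U * Y)" "i < dim_col (W * X + U * Y)"
  then have a: "a < n" and i: "i < k" by (auto simp: Y_def)
  have unit: "unit_vec n a \<bullet> (B *\<^sub>v s i) = (B *\<^sub>v s i) $ a" if "B \<in> carrier_mat n n" for B
    using a mult_mat_vec_carrier[OF that s_carrier] by (rule scalar_prod_left_unit[rotated])
  have w_unit: "w l \<bullet> unit_vec n a = w l $ a" "u l \<bullet> unit_vec n a = u l $ a" for l
    using a by simp_all
  have "Q $$ (a, i) = v i $ a + (A0 *\<^sub>v s i) $ a"
    using a i by (simp add: Q_def)
  also have "\<dots> = w i $ a - (A i *\<^sub>v s i) $ a + (A0 *\<^sub>v s i) $ a"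
    using a by (simp add: w_eq)
  also have "(A0 *\<^sub>v s i) $ a = (A i *\<^sub>v s i) $ a
      + (\<Sum>l<i. w l $ a * (w l \<bullet> s i) / (s l \<bullet> w l)) - (\<Sum>l<i. u l $ a * (u l \<bullet> s i) / (s l \<bullet> u l))"
    using bilinear_A[of "s i" "unit_vec n a" i] by (simp add: unit w_unit)
  also have "w i $ a - (A i *\<^sub>v s i) $ a + \<dots> =
      (\<Sum>l<Suc i. w l $ a * (w l \<bullet> s i) / (s l \<bullet> w l)) - (\<Sum>l<i. u l $ a * (u l \<bullet> s i) / (s l \<bullet> u l))"
    using sw[of i] by (simp add: comm_scalar_prod[of "w i" n "s i"])
  also have "(\<Sum>l<Suc i. w l $ a * (w l \<bullet> s i) / (s l \<bullet> w l)) = (W * X) $$ (a, i)"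
    unfolding index_mult_mat_sum[OF W_carrier X_carrier a i] using a i
    by (subst sum_if_less[of "Suc i" k, symmetric])
      (auto simp: X_def intro!: sum.cong)
  also have "(\<Sum>l<i. u l $ a * (u l \<bullet> s i) / (s l \<bullet> u l)) = - (U * Y) $$ (a, i)"
    unfolding index_mult_mat_sum[OF U_carrier Y_carrier a i] using a i
    by (subst sum_if_less[of i k, symmetric])
      (auto simp: Y_def sum_negf[symmetric] intro!: sum.cong)
  finally show "Q $$ (a, i) = (W * X + U * Y) $$ (a, i)"
    using a i by (simp add: Y_def)
qed (simp_all add: Q_def Y_def)

lemma QU_eq: "Q @\<^sub>c U = (W @\<^sub>c U) * T"
  unfolding T_def
  by (subst append_cols_mult_four_block_mat[of _ n k _ k _ k _ k]) (simp_all add: Q_eq)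

abbreviation "\<Sigma> \<equiv> mat_diag k (\<lambda>l. s l \<bullet> w l)"
abbreviation "\<Delta> \<equiv> mat_diag k (\<lambda>l. - (s l \<bullet> u l))"

lemma Y_scaled: "\<Delta> * Y = L\<^sub>U\<^sup>T"
  using su by (subst mat_diag_mult_left[of _ k k])
    (auto intro!: eq_matI simp: Y_def L\<^sub>U_def strict_lower_def comm_scalar_prod[of "u _" n "s _"])

lemma D\<^sub>U_eq: "- D\<^sub>U = \<Delta>"
  by (rule eq_matI) (auto simp: D\<^sub>U_def diag_part_def mat_diag_def)

text \<open>
  For \<open>i \<le> j\<close> the entry of the right-hand side at \<open>(i, j)\<close> is a sum over \<open>l \<le> i\<close> for the \<open>w\<^sub>l\<close> and
  over \<open>l < i\<close> for the \<open>u\<^sub>l\<close>. The terms with \<open>l < i\<close> add up to \<open>s\<^sub>j\<^sup>T (A\<^sub>0 - A\<^sub>i) s\<^sub>i\<close>, the remaining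
  one is \<open>s\<^sub>j\<^sup>T w\<^sub>i = s\<^sub>j\<^sup>T (A\<^sub>i s\<^sub>i + v\<^sub>i)\<close>; so \<open>A\<^sub>i\<close> cancels. Both sides are symmetric, which settles
  the entries with \<open>i > j\<close>.
\<close>

lemma upper_left_block: "D\<^sub>V + L\<^sub>V + L\<^sub>V\<^sup>T + S\<^sup>T * A0 * S = X\<^sup>T * \<Sigma> * X + Y\<^sup>T * \<Delta> * Y"
proof -
  define G where "G = D\<^sub>V + L\<^sub>V + L\<^sub>V\<^sup>T + S\<^sup>T * A0 * S"
  define H where "H = X\<^sup>T * \<Sigma> * X + Y\<^sup>T * \<Delta> * Y"
  have G: "G $$ (i, j) = (if i \<le> j then s j \<bullet> v i else s i \<bullet> v j) + s i \<bullet> (A0 *\<^sub>v s j)"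
    if "i < k" "j < k" for i j
  proof -
    have "col (A0 * S) j = A0 *\<^sub>v s j"
      using that by (subst col_mult2[of _ n n _ k]) simp_all
    then have "(S\<^sup>T * A0 * S) $$ (i, j) = s i \<bullet> (A0 *\<^sub>v s j)"
      using that by (subst assoc_mult_mat[of _ k n _ n _ k]) simp_all
    then show ?thesis
      using that by (simp add: G_def D\<^sub>V_def L\<^sub>V_def strict_lower_def diag_part_def mat_diag_def)
  qed
  have H: "H $$ (i, j) = (\<Sum>l = 0..<k. X $$ (l, i) * X $$ (l, j) * (s l \<bullet> w l))
      - (\<Sum>l = 0..<k. Y $$ (l, i) * Y $$ (l, j) * (s l \<bullet> u l))"
    if "i < k" "j < k" for i j
  proof -
    have "(F\<^sup>T * mat_diag k d * F) $$ (i, j) = (\<Sum>l = 0..<k. F $$ (l, i) * F $$ (l, j) * d l)"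
      if F: "F \<in> carrier_mat k k" for F and d :: "nat \<Rightarrow> 'a"
      using F \<open>i < k\<close> \<open>j < k\<close>
      by (subst index_mult_mat_sum[of _ k k _ k]) (auto simp: mat_diag_mult_right[of _ k k] intro!: sum.cong)
    from this[OF X_carrier] this[OF Y_carrier] that show ?thesis
      by (simp add: H_def sum_negf Y_def[THEN arg_cong[where f = dim_col]])
  qed
  have eq: "G $$ (i, j) = H $$ (i, j)" if le: "i \<le> j" and "j < k" for i j
  proof -
    have ij: "i < k" "j < k" using that by auto
    have "(\<Sum>l = 0..<k. X $$ (l, i) * X $$ (l, j) * (s l \<bullet> w l))
        = (\<Sum>l<Suc i. (w l \<bullet> s j) * (w l \<bullet> s i) / (s l \<bullet> w l))"
      using ij le sw by (subst sum_if_less[of "Suc i" k, symmetric])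
        (auto simp: X_def intro!: sum.cong)
    also have "\<dots> = (\<Sum>l<i. (w l \<bullet> s j) * (w l \<bullet> s i) / (s l \<bullet> w l)) + w i \<bullet> s j"
      using sw[of i] by (simp add: comm_scalar_prod[of "w i" n "s i"])
    finally have 1: "(\<Sum>l = 0..<k. X $$ (l, i) * X $$ (l, j) * (s l \<bullet> w l)) = \<dots>" .
    have 2: "(\<Sum>l = 0..<k. Y $$ (l, i) * Y $$ (l, j) * (s l \<bullet> u l))
        = (\<Sum>l<i. (u l \<bullet> s j) * (u l \<bullet> s i) / (s l \<bullet> u l))"
      using ij le su by (subst sum_if_less[of i k, symmetric])
        (auto simp: Y_def intro!: sum.cong)
    have "w i \<bullet> s j = s j \<bullet> w i"
      by (rule comm_scalar_prod[of _ n]) simp_all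
    also have "\<dots> = s j \<bullet> (A i *\<^sub>v s i) + s j \<bullet> v i"
      unfolding w_eq
      by (intro scalar_prod_add_distrib[of _ n] mult_mat_vec_carrier[of _ n n]) simp_all
    finally show ?thesis
      using le by (simp add: G[OF ij] H[OF ij] 1 2 bilinear_A dot_A0_commute[of "s j" "s i"])
  qed
  have sym: "G $$ (i, j) = G $$ (j, i)" "H $$ (i, j) = H $$ (j, i)" if "i < k" "j < k" for i j
    using that by (auto simp: G H dot_A0_commute[of "s j" "s i"] ac_simps)
  have "G = H"
  proof (rule eq_matI)
    fix i j assume "i < dim_row H" "j < dim_col H"
    then have ij: "i < k" "j < k" by (auto simp: H_def Y_def)
    show "G $$ (i, j) = H $$ (i, j)"
      using eq[of i j] eq[of j i] sym[OF ij] ij by (cases "i \<le> j") auto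
  qed (auto simp: G_def H_def Y_def)
  then show ?thesis unfolding G_def H_def .
qed

lemmas block_zero_one = right_mult_zero_mat[of _ k k] left_mult_zero_mat[of _ k k] left_add_zero_mat[of _ k k]
  right_add_zero_mat[of _ k k] left_mult_one_mat[of _ k k] right_mult_one_mat[of _ k k] mult_carrier_mat[of _ k k _ k]

text \<open>
  The off-diagonal blocks \<open>L\<^sub>U\<close> need no cancellation: the entries of \<open>Y\<close> are those of \<open>L\<^sub>U\<^sup>T\<close>
  divided by \<open>-\<tau>\<^sub>l\<close>.
\<close>

lemma M_eq: "M = T\<^sup>T * four_block_mat \<Sigma> (0\<^sub>m k k) (0\<^sub>m k k) \<Delta> * T"
proof -
  have "T\<^sup>T = four_block_mat (X\<^sup>T) (Y\<^sup>T) (0\<^sub>m k k) (1\<^sub>m k)"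
    by (simp add: T_def transpose_four_block_mat[of _ k k _ k _ k])
  then have "T\<^sup>T * four_block_mat \<Sigma> (0\<^sub>m k k) (0\<^sub>m k k) \<Delta> = four_block_mat (X\<^sup>T * \<Sigma>) (Y\<^sup>T * \<Delta>) (0\<^sub>m k k) \<Delta>"
    by (simp add: block_zero_one mult_four_block_mat[of _ k k _ k _ k _ _ k _ k])
  then have 1: "T\<^sup>T * four_block_mat \<Sigma> (0\<^sub>m k k) (0\<^sub>m k k) \<Delta> * T
      = four_block_mat (X\<^sup>T * \<Sigma> * X + Y\<^sup>T * \<Delta> * Y) (Y\<^sup>T * \<Delta>) (\<Delta> * Y) \<Delta>"
    by (simp add: T_def block_zero_one mult_four_block_mat[of _ k k _ k _ k _ _ k _ k])
  have "\<Delta>\<^sup>T = \<Delta>"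
    by (rule eq_matI) (auto simp: mat_diag_def)
  then have 2: "Y\<^sup>T * \<Delta> = L\<^sub>U"
    using transpose_mult[of \<Delta> k k Y k] by (simp add: Y_scaled)
  show ?thesis
    by (simp only: M_def upper_left_block D\<^sub>U_eq 1 2 Y_scaled)
qed

theorem compact_representation:
  "invertible_mat M \<and> A k = A0 - (Q @\<^sub>c U) * the (mat_inverse M) * (Q\<^sup>T @\<^sub>r U\<^sup>T)"
proof -
  define D where "D = four_block_mat \<Sigma> (0\<^sub>m k k) (0\<^sub>m k k) \<Delta>"
  define \<Sigma>' where "\<Sigma>' = mat_diag k (\<lambda>l. 1 / (s l \<bullet> w l))"
  define \<Delta>' where "\<Delta>' = mat_diag k (\<lambda>l. - 1 / (s l \<bullet> u l))"
  define E where "E = four_block_mat \<Sigma>' (0\<^sub>m k k) (0\<^sub>m k k) \<Delta>'"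
  have [simp]: "\<Sigma>' \<in> carrier_mat k k" "\<Delta>' \<in> carrier_mat k k" 
    by (simp_all add: \<Sigma>'_def \<Delta>'_def)
  have D: "D \<in> carrier_mat (k + k) (k + k)" and E: "E \<in> carrier_mat (k + k) (k + k)"
    unfolding D_def E_def by (intro four_block_carrier_mat mat_diag_dim; simp)+
  have Z: "W @\<^sub>c U \<in> carrier_mat n (k + k)"
    by (intro append_cols_carrier) simp_all
  have "\<Sigma> * \<Sigma>' = 1\<^sub>m k" "\<Delta> * \<Delta>' = 1\<^sub>m k"
    using sw su by (simp_all add: \<Sigma>'_def \<Delta>'_def)
  then have DE: "D * E = 1\<^sub>m (k + k)"
    by (simp add: D_def E_def block_zero_one mult_four_block_mat[of _ k k _ k _ k _ _ k _ k])
  note cong = congruence_inverse[OF T_carrier D E Z det_T DE,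
      folded QU_eq M_eq[folded D_def]]
  have "(W @\<^sub>c U) * E * (W @\<^sub>c U)\<^sup>T = ((W * \<Sigma>') @\<^sub>c (U * \<Delta>')) * (W\<^sup>T @\<^sub>r U\<^sup>T)"
    unfolding E_def transpose_append_cols[OF W_carrier U_carrier]
    by (subst append_cols_mult_four_block_mat[of _ n k _ k _ k _ k])
      (simp_all add: right_mult_zero_mat[of _ n k] left_add_zero_mat[of _ n k]
        right_add_zero_mat[of _ n k] mult_carrier_mat[of _ n k _ k])
  also have "\<dots> = W * \<Sigma>' * W\<^sup>T + U * \<Delta>' * U\<^sup>T"
    by (intro append_cols_mult_append_rows[of _ n k _ k _ n] mult_carrier_mat[of _ n k _ k]) auto
  finally have *: "(Q @\<^sub>c U) * the (mat_inverse M) * (Q\<^sup>T @\<^sub>r U\<^sup>T) = W * \<Sigma>' * W\<^sup>T + U * \<Delta>' * U\<^sup>T"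
    using cong(2) transpose_append_cols[OF Q_carrier U_carrier] by simp
  have "A k = A0 - (W * \<Sigma>' * W\<^sup>T + U * \<Delta>' * U\<^sup>T)"
  proof (rule eq_matI)
    fix a b assume "a < dim_row (A0 - (W * \<Sigma>' * W\<^sup>T + U * \<Delta>' * U\<^sup>T))"
      "b < dim_col (A0 - (W * \<Sigma>' * W\<^sup>T + U * \<Delta>' * U\<^sup>T))"
    then have ab: "a < n" "b < n" by auto
    have unit: "unit_vec n a \<bullet> (B *\<^sub>v unit_vec n b) = B $$ (a, b)" if "B \<in> carrier_mat n n" for B :: "'a mat"
      using ab that by simp
    have entry: "(F * mat_diag k d * F\<^sup>T) $$ (a, b) = (\<Sum>l<k. F $$ (a, l) * F $$ (b, l) * d l)"
      if "F \<in> carrier_mat n k" for F and d :: "nat \<Rightarrow> 'a"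
      using that ab by (subst index_mult_mat_sum[of _ n k _ n])
        (auto simp: mat_diag_mult_right[of _ n k] lessThan_atLeast0 intro!: sum.cong)
    have "(A0 - (W * \<Sigma>' * W\<^sup>T + U * \<Delta>' * U\<^sup>T)) $$ (a, b)
        = A0 $$ (a, b) - ((W * \<Sigma>' * W\<^sup>T) $$ (a, b) + (U * \<Delta>' * U\<^sup>T) $$ (a, b))"
      using ab by (simp del: index_mult_mat(1))
    then show "A k $$ (a, b) = (A0 - (W * \<Sigma>' * W\<^sup>T + U * \<Delta>' * U\<^sup>T)) $$ (a, b)"
      unfolding \<Sigma>'_def \<Delta>'_def entry[OF W_carrier] entry[OF U_carrier]
      using bilinear_A[of "unit_vec n b" "unit_vec n a" k] ab by (simp add: unit sum_negf)
  qed (use A_carrier[of k] in \<open>auto simp del: A_carrier\<close>)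
  with * cong(1) show ?thesis by simp
qed

end

end

section \<open>The structured BFGS-Plus recursion\<close>

theorem theorem2:
  fixes f khat uhat :: "real^'n \<Rightarrow> real"
    and x :: "nat \<Rightarrow> real^'n"
    and s v u :: "nat \<Rightarrow> real vec"
    and K A B :: "nat \<Rightarrow> real mat"
    and A0 S U V LU LV DU DV Q M :: "real mat"
    and n k :: nat
  assumes n: "n = CARD('n)"
    and f: "f = (\<lambda>y. khat y + uhat y)"
    and khat: "twice_continuously_differentiable khat"
    and uhat: "twice_continuously_differentiable uhat"
    and s: "\<And>i. s i = to_vec (x (i + 1) - x i)"
    and K: "\<And>i. K i = to_mat (hessian khat (x i))"
    and v: "\<And>i. v i = K (i + 1) *\<^sub>v s i"
    and u: "\<And>i. u i = K (i + 1) *\<^sub>v s i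
                      + to_vec (gradient uhat (x (i + 1)) - gradient uhat (x i))"
    and A0: "A0 \<in> carrier_mat n n" "A0\<^sup>T = A0"
    and A_0: "A 0 = A0"
    and A_rec: "\<And>i. A (i + 1) =
          A i - (1 / (s i \<bullet> (B i *\<^sub>v s i))) \<cdot>\<^sub>m (B i * outer_prod (s i) (s i) * B i)
              + (1 / (s i \<bullet> u i)) \<cdot>\<^sub>m outer_prod (u i) (u i)"
    and B: "\<And>i. B i = A i + K (i + 1)"
    and sBs: "\<And>i. s i \<bullet> (B i *\<^sub>v s i) \<noteq> 0"
    and su: "\<And>i. s i \<bullet> u i \<noteq> 0"
    and k: "k \<ge> 1"
    and S: "S = mat_of_cols n (map s [0..<k])"
    and U: "U = mat_of_cols n (map u [0..<k])"
    and V: "V = mat_of_cols n (map v [0..<k])"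
    and LU: "LU = strict_lower (S\<^sup>T * U)"
    and LV: "LV = strict_lower (S\<^sup>T * V)"
    and DU: "DU = diag_part (S\<^sup>T * U)"
    and DV: "DV = diag_part (S\<^sup>T * V)"
    and Q: "Q = V + A0 * S"
    and M: "M = four_block_mat (DV + LV + LV\<^sup>T + S\<^sup>T * A0 * S) LU
                               (LU\<^sup>T)                              (- DU)"
  shows "invertible_mat M \<and>
         A k = A0 - (Q @\<^sub>c U) * the (mat_inverse M) * (Q\<^sup>T @\<^sub>r U\<^sup>T)"
proof -
  define w where "w i = B i *\<^sub>v s i" for i
  have s_c: "s i \<in> carrier_vec n" and K_c: "K i \<in> carrier_mat n n" for i
    by (simp_all add: s K n to_vec_def to_mat_def)
  have v_c: "v i \<in> carrier_vec n" for i
    using K_c s_c by (simp add: v mult_mat_vec_carrier[of _ n n])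
  have u_c: "u i \<in> carrier_vec n" for i
  proof -
    have "to_vec (gradient uhat (x (i + 1)) - gradient uhat (x i)) \<in> carrier_vec n"
      by (simp add: n to_vec_def)
    then show ?thesis
      using v_c[of i] by (simp add: u v)
  qed
  have K_sym: "(K i)\<^sup>T = K i" for i
    by (simp add: K transpose_to_mat hessian_symmetric[OF khat])
  have outer_c: "outer_prod z z \<in> carrier_mat n n" if "z \<in> carrier_vec n" for z :: "real vec"
    using that by (auto simp: outer_prod_def)
  \<comment> \<open>Symmetry of \<open>B i\<close> turns \<open>B i s\<^sub>i s\<^sub>i\<^sup>T B i\<close> into a rank-one matrix built from \<open>w i\<close> alone.\<close>
  have rank_two: "A (Suc i) = A i - (1 / (s i \<bullet> w i)) \<cdot>\<^sub>m outer_prod (w i) (w i)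
                                + (1 / (s i \<bullet> u i)) \<cdot>\<^sub>m outer_prod (u i) (u i)"
    and w_c: "w i \<in> carrier_vec n"
    if A: "A i \<in> carrier_mat n n" "(A i)\<^sup>T = A i" for i
  proof -
    have B_c: "B i \<in> carrier_mat n n" and B_sym: "(B i)\<^sup>T = B i"
      using A K_c by (auto simp: B transpose_add[of _ n n] K_sym)
    show w: "w i \<in> carrier_vec n"
      unfolding w_def by (rule mult_mat_vec_carrier[OF B_c s_c])
    have "B i * outer_prod (s i) (s i) * B i = outer_prod (w i) (w i)"
      using mult_outer_prod[OF B_c s_c, of i "s i"] outer_prod_mult[OF B_c s_c, of "w i" i]
      by (simp add: B_sym w_def)
    then show "A (Suc i) = A i - (1 / (s i \<bullet> w i)) \<cdot>\<^sub>m outer_prod (w i) (w i)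
                                + (1 / (s i \<bullet> u i)) \<cdot>\<^sub>m outer_prod (u i) (u i)"
      using A_rec[of i] by (simp add: w_def)
  qed
  \<comment> \<open>Symmetry of \<open>A i\<close> and the rank-two form of the step \<open>i\<close> depend on each other, hence a joint induction.\<close>
  have A: "A i \<in> carrier_mat n n \<and> (A i)\<^sup>T = A i" for i
  proof (induction i)
    case 0
    then show ?case using A0 by (simp add: A_0)
  next
    case (Suc i)
    have "(c \<cdot>\<^sub>m outer_prod z z)\<^sup>T = c \<cdot>\<^sub>m outer_prod z z" for c :: real and z
      by (rule eq_matI) (auto simp: outer_prod_def mult.commute)
    moreover have "(P - R + N)\<^sup>T = P\<^sup>T - R\<^sup>T + N\<^sup>T"
      if "P \<in> carrier_mat n n" "R \<in> carrier_mat n n" "N \<in> carrier_mat n n" for P R N :: "real mat"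
      using that by (intro eq_matI) auto
    ultimately show ?case
      using Suc outer_c[OF w_c] outer_c[OF u_c] by (simp add: rank_two)
  qed
  interpret symmetric_two_term_update n A0 s u v w A
  proof
    show "w i = A i *\<^sub>v s i + v i" for i
      using A s_c K_c by (simp add: w_def B v add_mult_distrib_mat_vec[of _ n n])
    show "A (Suc i) = A i - (1 / (s i \<bullet> w i)) \<cdot>\<^sub>m outer_prod (w i) (w i)
                          + (1 / (s i \<bullet> u i)) \<cdot>\<^sub>m outer_prod (u i) (u i)" for i
      using A by (intro rank_two) auto
    show "s i \<bullet> w i \<noteq> 0" for i
      unfolding w_def by (rule sBs)
  qed (use s_c u_c v_c A A0 A_0 su in auto)
  show ?thesis
    using compact_representation[of k]
    by (simp only: S U V LU LV DU DV Q M S_def U_def V_def L\<^sub>U_def L\<^sub>V_def D\<^sub>U_def D\<^sub>V_def Q_def M_def)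
qed

end
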